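(* Let $M$ be a Riemannian submanifold of $\mathbb{R}^n$ (a smooth embedded submanifold with metric $g$ induced by the Euclidean inner product), let $\phi\colon U\to\mathbb{R}^k$, $U\subset\mathbb{R}^n$ open, be a local defining function of $M$, and let $$\psi\colon U\times\mathbb{R}^n\to\mathbb{R}^{2k},\qquad \psi(x,v)=(\phi(x),\mathrm{d}\phi_x(v)),$$ be the induced local defining function of $TM\subset\mathbb{R}^n\times\mathbb{R}^n$. Regard $TM$ as a Riemannian submanifold of $\mathbb{R}^n\times\mathbb{R}^n$. Let $\{(t_1,y_1),\ldots,(t_m,y_m)\}\subset\mathbb{R}\times M$ be a finite data set and $R\colon TM\to M$ a retraction. For each $i$ let $U_{y_i}\subset T_{y_i}M$ and $D_{y_i}\subset M$ be open sets such that $R_{y_i}\colon U_{y_i}\to D_{y_i}$ is a diffeomorphism, with inverse $R_{y_i}^{-1}\colon D_{y_i}\to U_{y_i}$. Put $V_{y_i}:=\{(x,v)\in TM:R_x(t_iv)\in D_{y_i}\}$, $V:=\bigcap_{i=1}^mV_{y_i}$, $h_i\colon V_{y_i}\to T_{y_i}M\subset\mathbb{R}^n$, $h_i(x,v):=R_{y_i}^{-1}(R_x(t_iv))$, and $\mathcal{F}_R\colon V\to[0,\infty)$, $\mathcal{F}_R(x,v)=\frac12\sum_{i=1}^m\langle h_i(x,v),h_i(x,v)\rangle$. Then, in the standard coordinates of $\mathbb{R}^n\times\mathbb{R}^n$, for every $(x,v)\in V$ with $x\in U$, $$\mathrm{grad}\,\mathcal{F}_R(x,v)=\sum_{i=1}^m\left(E_{2n}-J_\psi(x,v)^\top\left(J_\psi(x,v)J_\psi(x,v)^\top\right)^{-1}J_\psi(x,v)\right)\left(J_{h_i}(x,v)^\top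 h_i(x,v)\right).$$
   Context: A retraction on $M$ is a smooth map $R\colon TM\to M$ such that, with $R_x:=R|_{T_xM}$, for every $x\in M$ one has $R_x(0_x)=x$ and $(\mathrm{d}R_x)_{0_x}=\mathrm{id}_{T_xM}$ (identifying $T_{0_x}(T_xM)\simeq T_xM$). A local defining function of $M$ is a smooth map $\phi\colon U\to\mathbb{R}^k$ on an open set $U\subset\mathbb{R}^n$ such that $M\cap U$ is a regular level set of $\phi$ (so $\mathrm{d}\phi_x$ is surjective and $T_xM=\mathrm{Ker}(\mathrm{d}\phi_x)$ for $x\in M\cap U$); here $k$ is the codimension of $M$. Then $TM\cap(U\times\mathbb{R}^n)$ is a regular level set of $\psi$, of codimension $2k$ in $\mathbb{R}^n\times\mathbb{R}^n$. $E_{2n}$ is the $2n\times2n$ identity matrix. $J_\psi(x,v)$ is the $2k\times 2n$ Jacobian matrix of $\psi$. Functions on (open subsets of) an embedded submanifold are smoothly extended to a neighbourhood in the ambient Euclidean space, the extension being denoted by the same symbol; $J_{h_i}(x,v)$ is the $n\times 2n$ Jacobian matrix of any such smooth $\mathbb{R}^n$-valued extension of $h_i$ near $(x,v)$ in $\mathbb{R}^n\times\mathbb{R}^n$. The gradient is the Riemannian gradient with respect to the metric on $TM$ induced by the Euclidean metric of $\mathbb{R}^n\times\mathbb{R}^n$. *)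

theory Defs
  imports "HOL-Analysis.Analysis"
begin

section \<open>Smooth maps\<close>

text \<open>\<open>C_k_on k f S\<close> is meant for open \<open>S\<close>: all iterated directional derivatives of \<open>f\<close>
  of order at most \<open>k\<close> exist and are continuous on \<open>S\<close>.\<close>

primrec C_k_on ::
  "nat \<Rightarrow> ('a::euclidean_space \<Rightarrow> 'b::euclidean_space) \<Rightarrow> 'a set \<Rightarrow> bool" where
  "C_k_on 0 f S \<longleftrightarrow> continuous_on S f"
| "C_k_on (Suc k) f S \<longleftrightarrow>
     (\<forall>x\<in>S. f differentiable (at x)) \<and>
     (\<forall>v. C_k_on k (\<lambda>x. frechet_derivative f (at x) v) S)"

definition smooth_on ::
  "'a::euclidean_space set \<Rightarrow> ('a \<Rightarrow> 'b::euclidean_space) \<Rightarrow> bool" where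
  "smooth_on S f \<longleftrightarrow> (\<forall>k. C_k_on k f S)"

definition smooth_extension_near ::
  "'a::euclidean_space set \<Rightarrow> ('a \<Rightarrow> 'b::euclidean_space) \<Rightarrow> 'a \<Rightarrow> ('a \<Rightarrow> 'b) \<Rightarrow> bool" where
  "smooth_extension_near A f p g \<longleftrightarrow>
     (\<exists>W. open W \<and> p \<in> W \<and> smooth_on W g \<and> (\<forall>q \<in> W \<inter> A. g q = f q))"

text \<open>Smoothness on an arbitrary subset \<open>A\<close> of a Euclidean space (in particular on an open
  subset of an embedded submanifold) by local smooth extendability; only the values of \<open>f\<close> on
  \<open>A\<close> matter.\<close>

definition smooth_map_on ::
  "'a::euclidean_space set \<Rightarrow> ('a \<Rightarrow> 'b::euclidean_space) \<Rightarrow> bool" where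
  "smooth_map_on A f \<longleftrightarrow> (\<forall>p\<in>A. \<exists>g. smooth_extension_near A f p g)"

definition diffeomorphism_on ::
  "'a::euclidean_space set \<Rightarrow> 'b::euclidean_space set \<Rightarrow> ('a \<Rightarrow> 'b) \<Rightarrow> bool" where
  "diffeomorphism_on A B f \<longleftrightarrow>
     bij_betw f A B \<and> smooth_map_on A f \<and> smooth_map_on B (inv_into A f)"


section \<open>Embedded submanifolds of a Euclidean space\<close>

definition embedded_submanifold :: "nat \<Rightarrow> 'a::euclidean_space set \<Rightarrow> bool" where
  "embedded_submanifold d M \<longleftrightarrow>
     (\<forall>p\<in>M. \<exists>U (W :: 'a set) S \<Phi>.
        open U \<and> p \<in> U \<and> open W \<and> subspace S \<and> dim S = d \<and>
        diffeomorphism_on U W \<Phi> \<and> \<Phi> ` (M \<inter> U) = W \<inter> S)"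

definition smooth_curve_through ::
  "'a::euclidean_space set \<Rightarrow> 'a \<Rightarrow> (real \<Rightarrow> 'a) \<Rightarrow> bool" where
  "smooth_curve_through N p \<gamma> \<longleftrightarrow>
     (\<exists>e>0. smooth_on {-e<..<e} \<gamma> \<and> \<gamma> ` {-e<..<e} \<subseteq> N) \<and> \<gamma> 0 = p"

definition tangent_space :: "'a::euclidean_space set \<Rightarrow> 'a \<Rightarrow> 'a set" where
  "tangent_space N p = {vector_derivative \<gamma> (at 0) | \<gamma>. smooth_curve_through N p \<gamma>}"

definition tangent_bundle :: "'a::euclidean_space set \<Rightarrow> ('a \<times> 'a) set" where
  "tangent_bundle M = {(x, v). x \<in> M \<and> v \<in> tangent_space M x}"

text \<open>Riemannian gradient for the metric induced by the ambient inner product: the tangent vector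
  representing the differential, where \<open>df\<^sub>p\<close> applied to the velocity of a curve \<open>\<gamma>\<close> in \<open>N\<close> with
  \<open>\<gamma>(0) = p\<close> is the derivative of \<open>f \<circ> \<gamma>\<close> at \<open>0\<close>. It depends only on the values of \<open>f\<close>
  near \<open>p\<close> in \<open>N\<close>, so \<open>f\<close> need only be meaningful on an open subset of \<open>N\<close>.\<close>

definition has_riemannian_gradient ::
  "'a::euclidean_space set \<Rightarrow> ('a \<Rightarrow> real) \<Rightarrow> 'a \<Rightarrow> 'a \<Rightarrow> bool" where
  "has_riemannian_gradient N f p g \<longleftrightarrow>
     g \<in> tangent_space N p \<and>
     (\<forall>\<gamma>. smooth_curve_through N p \<gamma> \<longrightarrow>
        ((\<lambda>s. f (\<gamma> s)) has_real_derivative (g \<bullet> vector_derivative \<gamma> (at 0))) (at 0))"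

definition riemannian_gradient ::
  "'a::euclidean_space set \<Rightarrow> ('a \<Rightarrow> real) \<Rightarrow> 'a \<Rightarrow> 'a" where
  "riemannian_gradient N f p = (THE g. has_riemannian_gradient N f p g)"

text \<open>The condition \<open>(dR\<^sub>x)\<^sub>0 = id\<close> is on the linear space \<open>T\<^sub>xM\<close>, hence the derivative is taken
  within \<open>T\<^sub>xM\<close>.\<close>

definition manifold_retraction ::
  "'a::euclidean_space set \<Rightarrow> ('a \<times> 'a \<Rightarrow> 'a) \<Rightarrow> bool" where
  "manifold_retraction M R \<longleftrightarrow>
     R ` tangent_bundle M \<subseteq> M \<and>
     smooth_map_on (tangent_bundle M) R \<and>
     (\<forall>x\<in>M. R (x, 0) = x \<and>
        ((\<lambda>v. R (x, v)) has_derivative (\<lambda>v. v)) (at 0 within tangent_space M x))"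

text \<open>\<open>M \<inter> U\<close> is a regular level set of \<open>\<phi>\<close>; if it is nonempty, \<open>CARD('k)\<close> is necessarily
  the codimension of \<open>M\<close>.\<close>

definition local_defining_function ::
  "(real^'n) set \<Rightarrow> (real^'n) set \<Rightarrow> (real^'n \<Rightarrow> real^'k) \<Rightarrow> bool" where
  "local_defining_function M U \<phi> \<longleftrightarrow>
     open U \<and> smooth_on U \<phi> \<and>
     (\<exists>c. M \<inter> U = {x \<in> U. \<phi> x = c}) \<and>
     (\<forall>x \<in> M \<inter> U. surj (frechet_derivative \<phi> (at x)))"

definition induced_defining_function ::
  "(real^'n \<Rightarrow> real^'k) \<Rightarrow> (real^'n) \<times> (real^'n) \<Rightarrow> (real^'k) \<times> (real^'k)" where
  "induced_defining_function \<phi> = (\<lambda>(x, v). (\<phi> x, frechet_derivative \<phi> (at x) v))"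


section \<open>Standard coordinates of a product of two coordinate spaces\<close>

definition to_coords :: "(real^'a) \<times> (real^'a) \<Rightarrow> real^('a + 'a)" where
  "to_coords p = (\<chi> i. case i of Inl a \<Rightarrow> fst p $ a | Inr a \<Rightarrow> snd p $ a)"

definition of_coords :: "real^('a + 'a) \<Rightarrow> (real^'a) \<times> (real^'a)" where
  "of_coords z = (\<chi> a. z $ Inl a, \<chi> a. z $ Inr a)"

definition coord_jacobian ::
  "((real^'n) \<times> (real^'n) \<Rightarrow> real^'b) \<Rightarrow> (real^'n) \<times> (real^'n) \<Rightarrow> real^('n + 'n)^'b" where
  "coord_jacobian f p = jacobian (\<lambda>z. f (of_coords z)) (at (to_coords p))"


section \<open>The regression cost function\<close>

definition residual_domain ::
  "'a::euclidean_space set \<Rightarrow> ('a \<times> 'a \<Rightarrow> 'a) \<Rightarrow> real \<Rightarrow> 'a set \<Rightarrow> ('a \<times> 'a) set" where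
  "residual_domain M R t D = {(x, v) \<in> tangent_bundle M. R (x, t *\<^sub>R v) \<in> D}"

definition residual ::
  "('a::euclidean_space \<times> 'a \<Rightarrow> 'a) \<Rightarrow> real \<Rightarrow> 'a \<Rightarrow> 'a set \<Rightarrow> 'a \<times> 'a \<Rightarrow> 'a" where
  "residual R t y Uy = (\<lambda>(x, v). inv_into Uy (\<lambda>w. R (y, w)) (R (x, t *\<^sub>R v)))"

definition regression_domain ::
  "'a::euclidean_space set \<Rightarrow> ('a \<times> 'a \<Rightarrow> 'a) \<Rightarrow> nat \<Rightarrow> (nat \<Rightarrow> real) \<Rightarrow> (nat \<Rightarrow> 'a set)
     \<Rightarrow> ('a \<times> 'a) set" where
  "regression_domain M R m t D =
     tangent_bundle M \<inter> (\<Inter>i\<in>{1..m}. residual_domain M R (t i) (D i))"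

definition regression_cost ::
  "('a::euclidean_space \<times> 'a \<Rightarrow> 'a) \<Rightarrow> nat \<Rightarrow> (nat \<Rightarrow> real) \<Rightarrow> (nat \<Rightarrow> 'a) \<Rightarrow> (nat \<Rightarrow> 'a set)
     \<Rightarrow> 'a \<times> 'a \<Rightarrow> real" where
  "regression_cost R m t y Uy p =
     1 / 2 * (\<Sum>i=1..m. residual R (t i) (y i) (Uy i) p \<bullet> residual R (t i) (y i) (Uy i) p)"

end

theory Submission
  imports Defs
begin

text \<open>
  Along a curve \<open>\<gamma>\<close> in \<open>TM\<close> through \<open>p = (x, v)\<close> the cost coincides near time \<open>0\<close> with half the sum of
  the \<open>|H\<^sub>i|\<^sup>2\<close> for the smooth ambient extensions \<open>H\<^sub>i\<close> of the residuals \<open>h\<^sub>i\<close>, because the residual domains are relatively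
  open in \<open>TM\<close>. Hence its derivative is \<open>G \<bullet> \<gamma>'(0)\<close> with the ambient vector
  \<open>G = \<Sum>\<^sub>i J\<^sub>h\<^sub>i\<^sup>T h\<^sub>i\<close> (\<open>regression_cost_along_curve\<close>), and the Riemannian gradient is the orthogonal
  projection of \<open>G\<close> to the tangent space of \<open>TM\<close> at \<open>p\<close> (\<open>riemannian_gradient_eqI\<close>). When \<open>J\<close> has full row
  rank, \<open>I - J\<^sup>T (J J\<^sup>T)\<^sup>-\<^sup>1 J\<close> is the orthogonal projection onto the kernel of \<open>J\<close> (\<open>kernel_projection\<close>).

  The geometric content is therefore that the tangent space of \<open>TM\<close>, defined by velocities of smooth
  curves, is the whole kernel of \<open>d\<psi>\<close> (\<open>tangent_space_tangent_bundle\<close>). Velocities lie in the kernel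
  since \<open>\<psi>\<close> is constant on \<open>TM\<close>. Conversely, smooth curves are produced from the inverse \<open>\<Psi>\<close> of a
  straightening chart, which maps a subspace \<open>S\<close> locally onto \<open>M\<close>: straight lines in \<open>S\<close> give curves in
  \<open>M\<close>, and the tangent map of \<open>\<Psi>\<close> gives curves in \<open>TM\<close> (\<open>tangent_bundle_velocity\<close>). That enough
  velocities arise this way reduces to \<open>Ker d\<phi>\<^sub>x = d\<Psi>(S)\<close>, where the dimension of the chart and the
  codimension of the level set must be seen to match. This is proved in \<open>level_set_kernel\<close> by an open
  mapping argument. In codimension zero the tangent space of \<open>TM\<close> is everything and \<open>G\<close> itself is the gradient.
\<close>


section \<open>Calculus of smooth maps\<close>

lemma C_k_on_cong:
  assumes "open S" "\<And>x. x \<in> S \<Longrightarrow> f x = g x" "C_k_on k f S"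
  shows "C_k_on k g S"
  using assms(2,3)
proof (induction k arbitrary: f g)
  case 0
  then show ?case using continuous_on_cong[of S S f g] by simp
next
  case (Suc k)
  have D: "(g has_derivative frechet_derivative f (at x)) (at x)" if "x \<in> S" for x
    using Suc.prems that assms(1)
    by (intro has_derivative_transform_within_open[of f _ x UNIV S g])
      (auto simp flip: frechet_derivative_works)
  then have eq: "frechet_derivative f (at x) = frechet_derivative g (at x)" if "x \<in> S" for x
    using that by (blast intro: frechet_derivative_at)
  have "C_k_on k (\<lambda>x. frechet_derivative g (at x) v) S" for v
    by (rule Suc.IH[of "\<lambda>x. frechet_derivative f (at x) v"]) (use Suc.prems(2) eq in auto)
  with D show ?case by (auto simp: differentiable_def)
qed

lemma C_k_on_SucI:
  assumes "open S" "\<And>x. x \<in> S \<Longrightarrow> (f has_derivative f' x) (at x)"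
    and "\<And>v. C_k_on k (\<lambda>x. f' x v) S"
  shows "C_k_on (Suc k) f S"
proof -
  have eq: "f' x = frechet_derivative f (at x)" if "x \<in> S" for x
    using assms(2)[OF that] by (rule frechet_derivative_at)
  have "C_k_on k (\<lambda>x. frechet_derivative f (at x) v) S" for v
    by (rule C_k_on_cong[OF assms(1) _ assms(3)[of v]]) (simp add: eq)
  with assms(2) show ?thesis by (auto simp: differentiable_def)
qed

lemma C_k_on_subset: "C_k_on k f S \<Longrightarrow> T \<subseteq> S \<Longrightarrow> C_k_on k f T"
  by (induction k arbitrary: f) (auto intro: continuous_on_subset)

lemma C_k_on_Suc_imp: "C_k_on (Suc k) f S \<Longrightarrow> C_k_on k f S"
proof (induction k arbitrary: f)
  case 0
  then show ?case
    by (auto intro!: continuous_at_imp_continuous_on differentiable_imp_continuous_within)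
next
  case (Suc k)
  then show ?case by (metis C_k_on.simps(2))
qed

lemma C_k_on_has_derivative:
  "C_k_on (Suc k) f S \<Longrightarrow> x \<in> S \<Longrightarrow> (f has_derivative frechet_derivative f (at x)) (at x)"
  by (simp flip: frechet_derivative_works)

text \<open>The direction slot absorbs the inner map: the derivative of \<open>f (a + L s)\<close> in direction \<open>r\<close> is the
  directional derivative of \<open>f\<close> along the fixed vector \<open>L r\<close>, composed with the same affine map, so
  the induction on the order closes with a statement of the same shape.\<close>

lemma C_k_on_compose_affine:
  assumes L: "linear L" and W: "open W" and f: "C_k_on k f W"
  shows "C_k_on k (\<lambda>s. f (a + L s)) {s. a + L s \<in> W}"
  using f
proof (induction k arbitrary: f)
  case 0
  have "continuous_on {s. a + L s \<in> W} (\<lambda>s. a + L s)"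
    using L by (intro continuous_intros linear_continuous_on) (simp add: linear_conv_bounded_linear)
  then show ?case
    using 0 by (auto intro: continuous_on_compose2)
next
  case (Suc k)
  have aff: "((\<lambda>s. a + L s) has_derivative L) (at s)" for s
    using linear_imp_has_derivative[OF L, of "at s"] by (auto intro!: derivative_eq_intros)
  have "open ((\<lambda>s. a + L s) -` W)"
    using W L by (intro open_vimage continuous_intros linear_continuous_on)
      (simp_all add: linear_conv_bounded_linear)
  moreover have "((\<lambda>s. f (a + L s)) has_derivative
      (\<lambda>r. frechet_derivative f (at (a + L s)) (L r))) (at s)" if "a + L s \<in> W" for s
    using has_derivative_compose[OF aff C_k_on_has_derivative[OF Suc.prems that]] .
  moreover have "C_k_on k (\<lambda>s. frechet_derivative f (at (a + L s)) (L r)) {s. a + L s \<in> W}" for r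
    by (rule Suc.IH[of "\<lambda>z. frechet_derivative f (at z) (L r)"]) (use Suc.prems in simp)
  ultimately show ?case by (intro C_k_on_SucI) (auto simp: vimage_def)
qed

lemma C_k_on_linear_compose:
  assumes L: "linear L" and S: "open S" and f: "C_k_on k f S"
  shows "C_k_on k (\<lambda>x. L (f x)) S"
  using f
proof (induction k arbitrary: f)
  case 0
  then show ?case using L by (auto intro: continuous_on_compose2 linear_continuous_on
        simp: linear_conv_bounded_linear)
next
  case (Suc k)
  have "((\<lambda>x. L (f x)) has_derivative (\<lambda>v. L (frechet_derivative f (at x) v))) (at x)"
    if "x \<in> S" for x
    using C_k_on_has_derivative[OF Suc.prems that] L
    by (auto intro: bounded_linear.has_derivative simp: linear_conv_bounded_linear)
  with Suc S show ?case by (intro C_k_on_SucI) auto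
qed

lemma C_k_on_add:
  assumes S: "open S" and "C_k_on k f S" "C_k_on k g S"
  shows "C_k_on k (\<lambda>x. f x + g x) S"
  using assms(2,3)
proof (induction k arbitrary: f g)
  case 0
  then show ?case by (auto intro: continuous_intros)
next
  case (Suc k)
  have "((\<lambda>x. f x + g x) has_derivative
      (\<lambda>v. frechet_derivative f (at x) v + frechet_derivative g (at x) v)) (at x)"
    if "x \<in> S" for x
    using C_k_on_has_derivative[OF Suc.prems(1) that] C_k_on_has_derivative[OF Suc.prems(2) that]
    by (rule has_derivative_add)
  with Suc S show ?case by (intro C_k_on_SucI) auto
qed

lemma C_k_on_Pair:
  assumes S: "open S" and "C_k_on k f S" "C_k_on k g S"
  shows "C_k_on k (\<lambda>x. (f x, g x)) S"
proof -
  have "linear (\<lambda>a. (a, 0))" "linear (\<lambda>b. (0, b))"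
    by (auto intro!: linearI)
  then show ?thesis
    using C_k_on_add[OF S C_k_on_linear_compose[OF _ S assms(2)] C_k_on_linear_compose[OF _ S assms(3)]]
    by fastforce
qed

text \<open>For curves in the tangent bundle, which will have a fibre component that is
  affine in the parameter with smoothly varying coefficients.\<close>

lemma C_k_on_scaleR_ident:
  fixes f :: "real \<Rightarrow> 'b::euclidean_space"
  assumes S: "open S" and "C_k_on k f S"
  shows "C_k_on k (\<lambda>s. s *\<^sub>R f s) S"
  using assms(2)
proof (induction k arbitrary: f)
  case 0
  then show ?case by (auto intro: continuous_intros)
next
  case (Suc k)
  have "((\<lambda>s. s *\<^sub>R f s) has_derivative
      (\<lambda>r. s *\<^sub>R frechet_derivative f (at s) r + r *\<^sub>R f s)) (at s)" if "s \<in> S" for s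
    using C_k_on_has_derivative[OF Suc.prems that]
    by (auto intro!: derivative_eq_intros)
  moreover have "C_k_on k (\<lambda>s. r *\<^sub>R f s) S" for r
    using C_k_on_Suc_imp[OF Suc.prems] S
    by (intro C_k_on_linear_compose[where L = "\<lambda>a. r *\<^sub>R a"]) (auto intro: linearI simp: algebra_simps)
  moreover have "C_k_on k (\<lambda>s. s *\<^sub>R frechet_derivative f (at s) r) S" for r
    using Suc by simp
  ultimately show ?case
    by (intro C_k_on_SucI[OF S, where f' = "\<lambda>s r. s *\<^sub>R frechet_derivative f (at s) r + r *\<^sub>R f s"]
        C_k_on_add[OF S])
qed

lemma smooth_on_cong:
  "open S \<Longrightarrow> (\<And>x. x \<in> S \<Longrightarrow> f x = g x) \<Longrightarrow> smooth_on S f \<Longrightarrow> smooth_on S g"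
  unfolding smooth_on_def using C_k_on_cong[of S f g] by simp

lemma smooth_on_subset: "smooth_on S f \<Longrightarrow> T \<subseteq> S \<Longrightarrow> smooth_on T f"
  unfolding smooth_on_def using C_k_on_subset[of _ f S T] by simp

lemma smooth_on_has_derivative:
  "smooth_on S f \<Longrightarrow> x \<in> S \<Longrightarrow> (f has_derivative frechet_derivative f (at x)) (at x)"
  unfolding smooth_on_def using C_k_on_has_derivative[of 0 f S x] by metis

lemma smooth_on_isCont: "smooth_on S f \<Longrightarrow> x \<in> S \<Longrightarrow> isCont f x"
  using smooth_on_has_derivative has_derivative_continuous by blast

lemma smooth_on_directional_derivative:
  "smooth_on S f \<Longrightarrow> smooth_on S (\<lambda>x. frechet_derivative f (at x) v)"
  unfolding smooth_on_def by (metis C_k_on.simps(2))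

lemma smooth_on_line:
  assumes "smooth_on W f" "open W"
  shows "smooth_on {s. a + s *\<^sub>R w \<in> W} (\<lambda>s. f (a + s *\<^sub>R w))"
proof -
  have "linear (\<lambda>s::real. s *\<^sub>R w)" by (auto intro!: linearI simp: algebra_simps)
  with assms show ?thesis
    unfolding smooth_on_def using C_k_on_compose_affine[of "\<lambda>s. s *\<^sub>R w" W _ f a] by simp
qed

lemma open_line_preimage:
  fixes W :: "'a::real_normed_vector set"
  assumes "open W"
  shows "open {s::real. a + s *\<^sub>R w \<in> W}"
proof -
  have "open ((\<lambda>s. a + s *\<^sub>R w) -` W)"
    using assms by (intro open_vimage) (auto intro!: continuous_intros)
  then show ?thesis by (simp add: vimage_def)
qed

lemma smooth_map_on_openE:
  assumes "smooth_map_on A f" "p \<in> A" "open A"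
  obtains B where "open B" "p \<in> B" "B \<subseteq> A" "smooth_on B f"
proof -
  obtain g where "smooth_extension_near A f p g"
    using assms unfolding smooth_map_on_def by blast
  then obtain W where "open W" "p \<in> W" "smooth_on W g" "\<forall>q \<in> W \<inter> A. g q = f q"
    unfolding smooth_extension_near_def by blast
  then have "smooth_on (W \<inter> A) f"
    using assms smooth_on_subset[of W g "W \<inter> A"] by (intro smooth_on_cong[of "W \<inter> A" g f]) auto
  with \<open>open W\<close> \<open>p \<in> W\<close> assms show thesis by (intro that[of "W \<inter> A"]) auto
qed

lemma smooth_map_on_imp_continuous_on:
  assumes "smooth_map_on A f"
  shows "continuous_on A f"
proof (rule continuous_on_eq_continuous_within[THEN iffD2], rule)
  fix p assume p: "p \<in> A"
  then obtain g where "smooth_extension_near A f p g"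
    using assms unfolding smooth_map_on_def by blast
  then obtain W where W: "open W" "p \<in> W" "smooth_on W g" "\<forall>q \<in> W \<inter> A. g q = f q"
    unfolding smooth_extension_near_def by blast
  have "(g \<longlongrightarrow> g p) (at p within A)"
    using smooth_on_isCont[OF W(3,2)] unfolding isCont_def by (rule tendsto_within_subset) simp
  moreover have "eventually (\<lambda>q. g q = f q) (at p within A)"
    using W by (auto simp: eventually_at_topological)
  ultimately show "continuous (at p within A) f"
    using W p by (simp add: continuous_within tendsto_cong)
qed


section \<open>Tangent spaces\<close>

text \<open>Curves built from a parametrization come with an open parameter domain, not with the symmetric
  interval that the definition of a smooth curve asks for.\<close>

lemma tangent_spaceI:
  assumes "open T" "0 \<in> T" "smooth_on T \<gamma>" "\<gamma> ` T \<subseteq> N" "\<gamma> 0 = p"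
    and "(\<gamma> has_vector_derivative u) (at 0)"
  shows "u \<in> tangent_space N p"
proof -
  obtain e where e: "e > 0" "ball 0 e \<subseteq> T"
    using assms(1,2) openE by blast
  moreover have "ball 0 e = {-e<..<e}" by (auto simp: dist_real_def)
  ultimately have "smooth_curve_through N p \<gamma>"
    unfolding smooth_curve_through_def using assms(3-5)
    by (auto intro!: exI[of _ e] intro: smooth_on_subset)
  moreover have "vector_derivative \<gamma> (at 0) = u"
    using assms(6) by (rule vector_derivative_at)
  ultimately show ?thesis unfolding tangent_space_def by blast
qed

lemma smooth_curve_throughD:
  assumes "smooth_curve_through N p \<gamma>"
  shows "\<gamma> 0 = p" "(\<gamma> has_vector_derivative vector_derivative \<gamma> (at 0)) (at 0)"
    and "isCont \<gamma> 0" "\<forall>\<^sub>F s in nhds 0. \<gamma> s \<in> N"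
proof -
  obtain e where e: "e > 0" "smooth_on {-e<..<e} \<gamma>" "\<gamma> ` {-e<..<e} \<subseteq> N"
    using assms unfolding smooth_curve_through_def by blast
  show "\<gamma> 0 = p" using assms unfolding smooth_curve_through_def by blast
  have D: "(\<gamma> has_derivative frechet_derivative \<gamma> (at 0)) (at 0)"
    using e smooth_on_has_derivative by fastforce
  then have "\<gamma> differentiable (at 0)" by (auto simp: differentiable_def)
  then show "(\<gamma> has_vector_derivative vector_derivative \<gamma> (at 0)) (at 0)"
    by (simp add: vector_derivative_works)
  show "isCont \<gamma> 0" using D has_derivative_continuous by blast
  have "\<forall>\<^sub>F s in nhds 0. s \<in> {-e<..<e}" using e by (intro eventually_nhds_in_open) auto
  then show "\<forall>\<^sub>F s in nhds 0. \<gamma> s \<in> N" by eventually_elim (use e in auto)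
qed

lemma smooth_curve_eventually_in:
  assumes "smooth_curve_through N p \<gamma>" "open A" "p \<in> A"
  shows "\<forall>\<^sub>F s in nhds 0. \<gamma> s \<in> A"
proof -
  have "(\<gamma> \<longlongrightarrow> p) (nhds 0)"
    using smooth_curve_throughD(1,3)[OF assms(1)] tendsto_at_iff_tendsto_nhds[of \<gamma> 0]
    by (simp add: isCont_def)
  then show ?thesis using assms(2,3) by (rule topological_tendstoD)
qed

lemma has_derivative_along_curve:
  assumes "smooth_curve_through N p \<gamma>" "(f has_derivative f') (at p)"
  shows "((\<lambda>s. f (\<gamma> s)) has_vector_derivative f' (vector_derivative \<gamma> (at 0))) (at 0)"
proof -
  have "((f \<circ> \<gamma>) has_vector_derivative f' (vector_derivative \<gamma> (at 0))) (at 0)"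
    using smooth_curve_throughD(1,2)[OF assms(1)] assms(2)
    by (intro vector_derivative_diff_chain_within) (auto intro: has_derivative_at_withinI)
  then show ?thesis by (simp add: o_def)
qed

lemma tangent_space_subset_kernel:
  assumes "(f has_derivative f') (at p)" "open A" "p \<in> A" "\<And>z. z \<in> N \<inter> A \<Longrightarrow> f z = c"
  shows "tangent_space N p \<subseteq> {u. f' u = 0}"
proof
  fix u assume "u \<in> tangent_space N p"
  then obtain \<gamma> where \<gamma>: "smooth_curve_through N p \<gamma>" "u = vector_derivative \<gamma> (at 0)"
    unfolding tangent_space_def by blast
  have "\<forall>\<^sub>F s in nhds 0. f (\<gamma> s) = c"
    using smooth_curve_throughD(4)[OF \<gamma>(1)] smooth_curve_eventually_in[OF \<gamma>(1) assms(2,3)]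
    by eventually_elim (use assms(4) in auto)
  then have "((\<lambda>s. f (\<gamma> s)) has_vector_derivative 0) (at 0)"
    by (subst has_vector_derivative_cong_ev[where g = "\<lambda>_. c"])
      (auto dest: eventually_nhds_x_imp_x intro: eventually_mono)
  with has_derivative_along_curve[OF \<gamma>(1) assms(1)] have "f' (vector_derivative \<gamma> (at 0)) = 0"
    by (rule vector_derivative_unique_at)
  then show "u \<in> {u. f' u = 0}" using \<gamma>(2) by simp
qed

text \<open>Rescaling a vector amounts to rescaling the time of a curve realizing it. This also covers
  \<open>c = 0\<close>, and makes \<open>(x, v) \<mapsto> (x, t *\<^sub>R v)\<close> a self-map of the tangent bundle.\<close>

lemma tangent_space_scaleR:
  assumes "u \<in> tangent_space N p"
  shows "c *\<^sub>R u \<in> tangent_space N p"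
proof -
  obtain \<gamma> where \<gamma>: "smooth_curve_through N p \<gamma>" "u = vector_derivative \<gamma> (at 0)"
    using assms unfolding tangent_space_def by blast
  then obtain e where e: "e > 0" "smooth_on {-e<..<e} \<gamma>" "\<gamma> ` {-e<..<e} \<subseteq> N" "\<gamma> 0 = p"
    unfolding smooth_curve_through_def by blast
  let ?T = "{s. 0 + s *\<^sub>R c \<in> {-e<..<e}}"
  have "((\<gamma> \<circ> (\<lambda>s. s * c)) has_vector_derivative c *\<^sub>R u) (at 0)"
    using smooth_curve_throughD(2)[OF \<gamma>(1)] \<gamma>(2)
    by (intro vector_diff_chain_at) (auto intro!: derivative_eq_intros)
  then have "((\<lambda>s. \<gamma> (0 + s *\<^sub>R c)) has_vector_derivative c *\<^sub>R u) (at 0)"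
    by (simp add: o_def)
  moreover have "smooth_on ?T (\<lambda>s. \<gamma> (0 + s *\<^sub>R c))"
    using e(2) by (rule smooth_on_line) simp
  moreover have "open ?T" by (rule open_line_preimage) simp
  moreover have "(\<lambda>s. \<gamma> (0 + s *\<^sub>R c)) ` ?T \<subseteq> N" using e(3) by blast
  ultimately show ?thesis
    using e(1,4) tangent_spaceI[of ?T "\<lambda>s. \<gamma> (0 + s *\<^sub>R c)" N p "c *\<^sub>R u"] by simp
qed

lemma smooth_on_line_has_vector_derivative:
  assumes "smooth_on W f" "z \<in> W"
  shows "((\<lambda>s. f (z + s *\<^sub>R w)) has_vector_derivative frechet_derivative f (at z) w) (at 0)"
proof -
  have "((f \<circ> (\<lambda>s. z + s *\<^sub>R w)) has_vector_derivative frechet_derivative f (at z) w) (at 0)"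
  proof (rule vector_derivative_diff_chain_within)
    show "((\<lambda>s. z + s *\<^sub>R w) has_vector_derivative w) (at 0)"
      unfolding has_vector_derivative_def by (auto intro!: derivative_eq_intros)
    show "(f has_derivative frechet_derivative f (at z))
        (at (z + 0 *\<^sub>R w) within range (\<lambda>s. z + s *\<^sub>R w))"
      using smooth_on_has_derivative[OF assms] by (simp add: has_derivative_at_withinI)
  qed
  then show ?thesis by (simp add: o_def)
qed

lemma frechet_derivative_in_tangent_space:
  assumes "open W" "smooth_on W \<Psi>" "z \<in> W"
    and "\<And>s. z + s *\<^sub>R w \<in> W \<Longrightarrow> \<Psi> (z + s *\<^sub>R w) \<in> N"
  shows "frechet_derivative \<Psi> (at z) w \<in> tangent_space N (\<Psi> z)"
proof (rule tangent_spaceI)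
  show "open {s. z + s *\<^sub>R w \<in> W}" using assms(1) by (rule open_line_preimage)
  show "smooth_on {s. z + s *\<^sub>R w \<in> W} (\<lambda>s. \<Psi> (z + s *\<^sub>R w))"
    using assms(2,1) by (rule smooth_on_line)
  show "((\<lambda>s. \<Psi> (z + s *\<^sub>R w)) has_vector_derivative frechet_derivative \<Psi> (at z) w) (at 0)"
    using assms(2,3) by (rule smooth_on_line_has_vector_derivative)
qed (use assms(3,4) in auto)

lemma tangent_space_open:
  assumes "open A" "p \<in> A" "A \<subseteq> N"
  shows "tangent_space N p = UNIV"
proof -
  have id: "smooth_on A (\<lambda>z. z)"
    unfolding smooth_on_def
  proof
    fix k
    have const: "C_k_on j (\<lambda>_. v) A" for j and v :: 'a by (induction j arbitrary: v) auto
    show "C_k_on k (\<lambda>z. z) A" by (cases k) (auto simp: const)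
  qed
  have "w \<in> tangent_space N p" for w
    using frechet_derivative_in_tangent_space[OF assms(1) id assms(2), of w N] assms(3) by auto
  then show ?thesis by auto
qed

section \<open>Submanifolds in a smooth parametrization\<close>

text \<open>The image of the straight motion \<open>(q + s w, w0 + s w1)\<close> in the flat model \<open>S \<times> S\<close> under the tangent
  map of the parametrization \<open>\<Psi>\<close>. Since \<open>D\<Psi>\<close> is linear in the fibre, the curve is
  \<open>(\<Psi> z, D\<Psi>\<^sub>z w0 + s D\<Psi>\<^sub>z w1)\<close> at \<open>z = q + s w\<close>; the velocity at \<open>s = 0\<close> consists of \<open>D\<Psi>\<^sub>q w\<close>
  and \<open>D\<^sup>2\<Psi>\<^sub>q(w, w0) + D\<Psi>\<^sub>q w1\<close>.\<close>

lemma tangent_bundle_velocity: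
  assumes W: "open W" and \<Psi>: "smooth_on W \<Psi>" and S: "subspace S"
    and M: "\<And>z. z \<in> W \<inter> S \<Longrightarrow> \<Psi> z \<in> M"
    and q: "q \<in> W \<inter> S" and w: "w \<in> S" "w0 \<in> S" "w1 \<in> S"
  shows "(frechet_derivative \<Psi> (at q) w,
      frechet_derivative (\<lambda>z. frechet_derivative \<Psi> (at z) w0) (at q) w + frechet_derivative \<Psi> (at q) w1)
    \<in> tangent_space (tangent_bundle M) (\<Psi> q, frechet_derivative \<Psi> (at q) w0)"
proof -
  let ?T = "{s. q + s *\<^sub>R w \<in> W}"
  let ?D = "\<lambda>u z. frechet_derivative \<Psi> (at z) u"
  let ?\<gamma> = "\<lambda>s. (\<Psi> (q + s *\<^sub>R w), ?D w0 (q + s *\<^sub>R w) + s *\<^sub>R ?D w1 (q + s *\<^sub>R w))"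
  have D: "smooth_on W (?D u)" for u
    using \<Psi> by (rule smooth_on_directional_derivative)
  have T: "open ?T" using W by (rule open_line_preimage)
  have "smooth_on ?T ?\<gamma>"
    using smooth_on_line[OF \<Psi> W, of q w] smooth_on_line[OF D W, of q w]
    unfolding smooth_on_def by (simp add: T C_k_on_Pair C_k_on_add C_k_on_scaleR_ident)
  moreover have "?\<gamma> s \<in> tangent_bundle M" if "s \<in> ?T" for s
  proof -
    let ?z = "q + s *\<^sub>R w"
    have z: "?z \<in> W \<inter> S" using that q w S by (auto intro: subspace_add subspace_scale)
    have "linear (frechet_derivative \<Psi> (at ?z))"
      using z smooth_on_has_derivative[OF \<Psi>] by (blast intro: has_derivative_linear)
    then have "?D w0 ?z + s *\<^sub>R ?D w1 ?z = ?D (w0 + s *\<^sub>R w1) ?z"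
      by (simp add: linear_add linear_cmul)
    moreover have "?D (w0 + s *\<^sub>R w1) ?z \<in> tangent_space M (\<Psi> ?z)"
      using z w S M
      by (intro frechet_derivative_in_tangent_space[OF W \<Psi>]) (auto intro!: subspace_add subspace_scale)
    ultimately show ?thesis using M[OF z] by (simp add: tangent_bundle_def)
  qed
  moreover have "(?\<gamma> has_vector_derivative
      (?D w q, frechet_derivative (?D w0) (at q) w + ?D w1 q)) (at 0)"
  proof -
    have "((\<lambda>s. s *\<^sub>R ?D w1 (q + s *\<^sub>R w)) has_vector_derivative ?D w1 q) (at 0)"
      using has_vector_derivative_scaleR[OF DERIV_ident smooth_on_line_has_vector_derivative[OF D[of w1], of q w]] q
      by simp
    then show ?thesis
      using smooth_on_line_has_vector_derivative[OF \<Psi>, of q w] smooth_on_line_has_vector_derivative[OF D[of w0], of q w] q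
      by (intro has_vector_derivative_Pair has_vector_derivative_add) auto
  qed
  ultimately show ?thesis
    using T q by (intro tangent_spaceI[of ?T ?\<gamma>]) auto
qed

text \<open>Inverse of a straightening chart, restricted to a neighbourhood on which it is smooth. The
  surjectivity of its derivative at \<open>q\<close> comes from differentiating \<open>\<Psi> \<circ> \<Phi> = id\<close> for the chart \<open>\<Phi>\<close>.\<close>

lemma embedded_submanifold_parametrization:
  fixes M :: "'a::euclidean_space set"
  assumes "embedded_submanifold d M" "x \<in> M"
  obtains W S :: "'a set" and \<Psi> q where "open W" "subspace S" "q \<in> W" "smooth_on W \<Psi>" "\<Psi> q = x"
    "\<And>z. z \<in> W \<Longrightarrow> \<Psi> z \<in> M \<longleftrightarrow> z \<in> S" "surj (frechet_derivative \<Psi> (at q))"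
proof -
  obtain U W S and \<Phi> :: "'a \<Rightarrow> 'a" where UW: "open U" "x \<in> U" "open W" "subspace S" "diffeomorphism_on U W \<Phi>"
    and img: "\<Phi> ` (M \<inter> U) = W \<inter> S"
    using bspec[OF assms(1)[unfolded embedded_submanifold_def] assms(2)] by auto
  define \<Psi> where "\<Psi> = inv_into U \<Phi>"
  have bij: "bij_betw \<Phi> U W" and sm: "smooth_map_on U \<Phi>" "smooth_map_on W \<Psi>"
    using UW(5) unfolding diffeomorphism_on_def \<Psi>_def by auto
  have W: "\<Phi> x \<in> W" using bij UW(2) by (auto simp: bij_betw_def)
  obtain B where B: "open B" "\<Phi> x \<in> B" "B \<subseteq> W" "smooth_on B \<Psi>"
    using smooth_map_on_openE[OF sm(2) W UW(3)] .
  obtain A where A: "open A" "x \<in> A" "A \<subseteq> U" "smooth_on A \<Phi>"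
    using smooth_map_on_openE[OF sm(1) UW(2,1)] .
  have left: "\<Psi> (\<Phi> z) = z" if "z \<in> U" for z
    using that bij unfolding \<Psi>_def by (simp add: bij_betw_def)
  have right: "\<Phi> (\<Psi> z) = z" "\<Psi> z \<in> U" if "z \<in> W" for z
    using that bij unfolding \<Psi>_def
    by (auto simp: bij_betw_inv_into_right) (metis bij_betw_def inv_into_into)
  have "\<Psi> z \<in> M \<longleftrightarrow> z \<in> S" if "z \<in> B" for z
  proof
    assume "\<Psi> z \<in> M"
    moreover have zW: "z \<in> W" using that B(3) by blast
    ultimately have "\<Phi> (\<Psi> z) \<in> \<Phi> ` (M \<inter> U)" using right(2)[OF zW] by (intro imageI) simp
    then show "z \<in> S" using right(1)[OF zW] by (simp add: img)
  next
    assume "z \<in> S"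
    then have "z \<in> \<Phi> ` (M \<inter> U)" using that B(3) unfolding img by blast
    then obtain y where "y \<in> M \<inter> U" "z = \<Phi> y" by (elim imageE) simp
    then show "\<Psi> z \<in> M" using left by simp
  qed
  moreover have "surj (frechet_derivative \<Psi> (at (\<Phi> x)))"
  proof -
    let ?L = "frechet_derivative \<Psi> (at (\<Phi> x)) \<circ> frechet_derivative \<Phi> (at x)"
    have "((\<Psi> \<circ> \<Phi>) has_derivative ?L) (at x)"
      using smooth_on_has_derivative[OF A(4,2)] smooth_on_has_derivative[OF B(4,2)]
      by (rule diff_chain_at)
    then have "((\<lambda>z. z) has_derivative ?L) (at x)"
      by (rule has_derivative_transform_within_open[OF _ UW(1,2)]) (simp add: left)
    then have "?L = (\<lambda>z. z)" using has_derivative_ident by (rule has_derivative_unique)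
    then have "frechet_derivative \<Psi> (at (\<Phi> x)) (frechet_derivative \<Phi> (at x) z) = z" for z
      by (metis comp_apply)
    then show ?thesis by (rule surjI)
  qed
  ultimately show thesis using B UW(4) left[OF UW(2)] by (intro that[of B S "\<Phi> x" \<Psi>]) auto
qed

text \<open>Every vector in the kernel of the defining function's derivative is tangent to \<open>M\<close>. This is where
  the codimension of the level set is matched with the dimension of \<open>S\<close>. Lift the vector to \<open>w' = w + u\<close> with \<open>w \<in> S\<close> and \<open>u\<close> orthogonal to \<open>S\<close>. If \<open>u \<noteq> 0\<close>,
  the map \<open>z \<mapsto> (\<phi> (\<Psi> z), u \<bullet> z)\<close> is a submersion at \<open>q\<close>, because \<open>u\<close> is killed by the derivative of
  \<open>\<phi> \<circ> \<Psi>\<close> but not by \<open>u \<bullet> _\<close>. So it takes a value \<open>(c, \<epsilon>/2)\<close> with \<open>\<epsilon> > 0\<close> near \<open>q\<close>. A preimage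
  lies on the level set, hence in \<open>S\<close>, yet is not orthogonal to \<open>u\<close>.\<close>

lemma level_set_kernel:
  fixes \<phi> :: "'a::euclidean_space \<Rightarrow> 'b::euclidean_space"
  assumes W: "open W" and S: "subspace S" and q: "q \<in> W" and \<Psi>: "smooth_on W \<Psi>"
    and M: "\<And>z. z \<in> W \<Longrightarrow> \<Psi> z \<in> M \<longleftrightarrow> z \<in> S" and surj\<Psi>: "surj (frechet_derivative \<Psi> (at q))"
    and U: "open U" "smooth_on U \<phi>" "\<Psi> q \<in> M \<inter> U" "M \<inter> U = {x \<in> U. \<phi> x = c}"
    and surj\<phi>: "surj (frechet_derivative \<phi> (at (\<Psi> q)))"
    and a: "frechet_derivative \<phi> (at (\<Psi> q)) a = 0"
  obtains w where "w \<in> S" "frechet_derivative \<Psi> (at q) w = a"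
proof -
  define \<Psi>' \<phi>' where "\<Psi>' = frechet_derivative \<Psi> (at q)" and "\<phi>' = frechet_derivative \<phi> (at (\<Psi> q))"
  have D\<Psi>: "(\<Psi> has_derivative \<Psi>') (at q)" and D\<phi>: "(\<phi> has_derivative \<phi>') (at (\<Psi> q))"
    using smooth_on_has_derivative \<Psi> q U unfolding \<Psi>'_def \<phi>'_def by blast+
  note lin = D\<Psi>[THEN has_derivative_linear] D\<phi>[THEN has_derivative_linear]
  have qS: "q \<in> S" using M q U(3) by blast
  obtain w' where w': "\<Psi>' w' = a" using surj\<Psi> unfolding \<Psi>'_def by (metis surjD)
  obtain w u where wu: "w \<in> span S" "\<And>s. s \<in> span S \<Longrightarrow> orthogonal u s" "w' = w + u"
    using orthogonal_subspace_decomp_exists[of S w'] by blast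
  have spanS: "span S = S" using S by (simp add: span_eq_iff)
  have "\<Psi>' w \<in> tangent_space M (\<Psi> q)"
    unfolding \<Psi>'_def using M q qS wu(1) S spanS
    by (intro frechet_derivative_in_tangent_space[OF W \<Psi>]) (auto intro!: subspace_add subspace_scale)
  then have "\<phi>' (\<Psi>' w) = 0"
    using tangent_space_subset_kernel[OF D\<phi> U(1), of M c] U(3,4) by blast
  moreover have "\<phi>' (\<Psi>' w') = \<phi>' (\<Psi>' w) + \<phi>' (\<Psi>' u)"
    using lin by (simp add: wu(3) linear_add)
  ultimately have ker: "\<phi>' (\<Psi>' u) = 0"
    using a w' unfolding \<phi>'_def by simp
  have "u = 0"
  proof (rule ccontr)
    assume u: "u \<noteq> 0"
    let ?A = "W \<inter> \<Psi> -` U"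
    have cont\<Psi>: "continuous_on W \<Psi>"
      using smooth_on_isCont[OF \<Psi>] by (simp add: continuous_at_imp_continuous_on)
    have A: "open ?A" using cont\<Psi> W U(1) by (simp add: continuous_on_open_vimage Int_commute)
    let ?F = "\<lambda>z. (\<phi> (\<Psi> z), u \<bullet> z)" and ?F' = "\<lambda>h. (\<phi>' (\<Psi>' h), u \<bullet> h)"
    have F: "(?F has_derivative ?F') (at q)"
      using D\<Psi> D\<phi> by (intro has_derivative_Pair has_derivative_compose[of \<Psi> \<Psi>' q UNIV \<phi> \<phi>']
          has_derivative_inner_right has_derivative_ident)
    have "continuous_on ?A ?F"
    proof (intro continuous_on_Pair continuous_on_compose2[of U \<phi> ?A \<Psi>])
      show "continuous_on U \<phi>"
        using smooth_on_isCont[OF U(2)] by (simp add: continuous_at_imp_continuous_on)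
      show "continuous_on ?A \<Psi>" using cont\<Psi> by (rule continuous_on_subset) simp
    qed (auto intro: continuous_intros)
    moreover have "surj ?F'"
    proof -
      have "\<exists>h. (\<alpha>, \<beta>) = ?F' h" for \<alpha> \<beta>
      proof -
        obtain k where k: "\<phi>' k = \<alpha>" using surjD[OF surj\<phi>[folded \<phi>'_def], of \<alpha>] by auto
        obtain h where "\<Psi>' h = k" using surjD[OF surj\<Psi>[folded \<Psi>'_def], of k] by auto
        with k have h: "\<phi>' (\<Psi>' h) = \<alpha>" by simp
        have "(\<alpha>, \<beta>) = ?F' (h + ((\<beta> - u \<bullet> h) / (u \<bullet> u)) *\<^sub>R u)"
          using u h ker lin by (simp add: linear_add linear_cmul inner_add_right)
        then show ?thesis ..
      qed
      then show ?thesis unfolding surj_def split_paired_All by blast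
    qed
    then obtain g where "linear g" "?F' \<circ> g = id"
      using linear_surjective_right_inverse[OF has_derivative_linear[OF F]] by metis
    then have "bounded_linear g" "?F' \<circ> g = id" by (auto simp: linear_conv_bounded_linear)
    moreover have qA: "q \<in> ?A" using q U(3) by simp
    moreover have "q \<in> interior ?A" using qA by (simp only: interior_open[OF A])
    ultimately have "?F q \<in> interior (?F ` ?A)"
      using sussmann_open_mapping[OF A _ _ F _ _ subset_refl, of g] by blast
    moreover have "?F q = (c, 0)"
      using U(3,4) wu(2) qS spanS by (auto simp: orthogonal_def)
    ultimately have "(c, 0) \<in> interior (?F ` ?A)" by metis
    then obtain \<epsilon> where \<epsilon>: "\<epsilon> > 0" "ball (c, 0) \<epsilon> \<subseteq> ?F ` ?A"
      unfolding mem_interior by (elim exE conjE)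
    have "(c, \<epsilon> / 2) \<in> ball (c, 0) \<epsilon>" using \<epsilon>(1) by (simp add: dist_Pair_Pair)
    then have "(c, \<epsilon> / 2) \<in> ?F ` ?A" using \<epsilon>(2) by blast
    then obtain z where z: "z \<in> ?A" "\<phi> (\<Psi> z) = c" "u \<bullet> z = \<epsilon> / 2" by (elim imageE) simp
    then have "z \<in> S" using U(4) M by auto
    then show False using wu(2)[of z] spanS z(3) \<epsilon>(1) by (simp add: orthogonal_def)
  qed
  then show thesis using that[of w] wu(1,3) w' spanS \<Psi>'_def by simp
qed

section \<open>The tangent bundle as a level set\<close>

text \<open>Expanding the fibre variable in the standard basis turns \<open>d\<phi>\<^sub>p(w)\<close> into a finite sum of products of
  a linear form in \<open>w\<close> with a smooth function of \<open>p\<close>. The resulting derivative is block triangular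
  with \<open>d\<phi>\<^sub>x\<close> in both diagonal blocks. The off-diagonal block \<open>B\<close> is the
  second derivative of \<open>\<phi>\<close> contracted with \<open>v\<close>.\<close>

lemma induced_defining_function_has_derivative:
  assumes U: "open U" "smooth_on U \<phi>" "x \<in> U"
  obtains B where "(induced_defining_function \<phi> has_derivative
    (\<lambda>(a, b). (frechet_derivative \<phi> (at x) a, B a + frechet_derivative \<phi> (at x) b))) (at (x, v))"
proof -
  let ?\<phi>' = "frechet_derivative \<phi> (at x)"
  let ?D = "\<lambda>e p. frechet_derivative \<phi> (at p) e"
  let ?\<psi> = "\<lambda>z. (\<phi> (fst z), \<Sum>e\<in>Basis. (snd z \<bullet> e) *\<^sub>R ?D e (fst z))"
  define B where "B = (\<lambda>a. \<Sum>e\<in>Basis. (v \<bullet> e) *\<^sub>R frechet_derivative (?D e) (at x) a)"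
  have expand: "frechet_derivative \<phi> (at p) w = (\<Sum>e\<in>Basis. (w \<bullet> e) *\<^sub>R ?D e p)" if "p \<in> U" for p w
  proof -
    have "linear (frechet_derivative \<phi> (at p))"
      using smooth_on_has_derivative[OF U(2) that] by (rule has_derivative_linear)
    then show ?thesis
      by (subst (1) euclidean_representation[of w, symmetric]) (simp add: linear_sum linear_cmul)
  qed
  have fst: "((\<lambda>z. f (fst z)) has_derivative (\<lambda>z. frechet_derivative f (at x) (fst z))) (at (x, v))"
    if "smooth_on U f" for f :: "(real, 'a) vec \<Rightarrow> (real, 'b) vec"
    by (rule has_derivative_compose[where f = fst])
      (use smooth_on_has_derivative[OF that U(3)] in \<open>auto intro!: derivative_eq_intros\<close>)
  have D: "((\<lambda>z. ?D e (fst z)) has_derivative (\<lambda>z. frechet_derivative (?D e) (at x) (fst z))) (at (x, v))" for e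
    by (rule fst[OF smooth_on_directional_derivative[OF U(2)]])
  have "((\<lambda>z. (snd z \<bullet> e) *\<^sub>R ?D e (fst z)) has_derivative
      (\<lambda>z. (v \<bullet> e) *\<^sub>R frechet_derivative (?D e) (at x) (fst z) + (snd z \<bullet> e) *\<^sub>R ?\<phi>' e)) (at (x, v))" for e
    using has_derivative_scaleR[OF has_derivative_inner_left[OF has_derivative_snd[OF has_derivative_ident]] D[of e], of e]
    by simp
  then have "(?\<psi> has_derivative (\<lambda>z. (?\<phi>' (fst z),
      \<Sum>e\<in>Basis. (v \<bullet> e) *\<^sub>R frechet_derivative (?D e) (at x) (fst z) + (snd z \<bullet> e) *\<^sub>R ?\<phi>' e))) (at (x, v))"
    by (intro has_derivative_Pair has_derivative_sum fst[OF U(2)])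
  moreover have "(\<Sum>e\<in>Basis. (v \<bullet> e) *\<^sub>R frechet_derivative (?D e) (at x) a + (b \<bullet> e) *\<^sub>R ?\<phi>' e)
      = B a + ?\<phi>' b" for a b
    by (subst expand[OF U(3), of b]) (simp add: B_def sum.distrib)
  ultimately have "(?\<psi> has_derivative (\<lambda>(a, b). (?\<phi>' a, B a + ?\<phi>' b))) (at (x, v))"
    by (simp add: case_prod_unfold)
  then have "(induced_defining_function \<phi> has_derivative (\<lambda>(a, b). (?\<phi>' a, B a + ?\<phi>' b))) (at (x, v))"
  proof (rule has_derivative_transform_within_open)
    show "open (U \<times> UNIV)" using U(1) by (intro open_Times) auto
    show "(x, v) \<in> U \<times> UNIV" using U(3) by simp
    show "?\<psi> z = induced_defining_function \<phi> z" if "z \<in> U \<times> UNIV" for z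
      using that by (cases z) (simp add: induced_defining_function_def flip: expand)
  qed
  then show thesis by (rule that)
qed

text \<open>Curves in \<open>TM\<close> stay in a level set of \<open>\<psi>\<close>, which gives one inclusion. For the other, match the base
  component \<open>a\<close> first by some \<open>w \<in> S\<close>. The curve with this \<open>w\<close> and \<open>w1 = 0\<close> has a velocity \<open>(a, b')\<close>,
  which lies in the kernel of \<open>\<psi>'\<close> by the first inclusion; hence \<open>b - b'\<close> is in the kernel of
  \<open>d\<phi>\<^sub>x\<close> and can be supplied by \<open>w1\<close>.\<close>

lemma tangent_space_tangent_bundle:
  fixes M :: "(real^'n) set" and \<phi> :: "real^'n \<Rightarrow> real^'k"
  assumes M: "embedded_submanifold d M" and "local_defining_function M U \<phi>"
    and x: "x \<in> U" and xv: "(x, v) \<in> tangent_bundle M"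
  defines "\<psi>' \<equiv> frechet_derivative (induced_defining_function \<phi>) (at (x, v))"
  shows "(induced_defining_function \<phi> has_derivative \<psi>') (at (x, v))"
    and "surj \<psi>'"
    and "tangent_space (tangent_bundle M) (x, v) = {u. \<psi>' u = 0}"
proof -
  let ?\<phi>' = "frechet_derivative \<phi> (at x)"
  obtain c where U: "open U" "smooth_on U \<phi>" "M \<inter> U = {x \<in> U. \<phi> x = c}"
    and surj\<phi>: "\<And>p. p \<in> M \<inter> U \<Longrightarrow> surj (frechet_derivative \<phi> (at p))"
    using assms(2) unfolding local_defining_function_def by blast
  have xM: "x \<in> M" and vT: "v \<in> tangent_space M x" using xv by (auto simp: tangent_bundle_def)
  obtain B where B: "(induced_defining_function \<phi> has_derivative
      (\<lambda>(a, b). (?\<phi>' a, B a + ?\<phi>' b))) (at (x, v))"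
    using induced_defining_function_has_derivative[OF U(1,2) x] .
  then have \<psi>': "\<psi>' = (\<lambda>(a, b). (?\<phi>' a, B a + ?\<phi>' b))"
    unfolding \<psi>'_def by (rule frechet_derivative_at[symmetric])
  with B show D: "(induced_defining_function \<phi> has_derivative \<psi>') (at (x, v))" by simp
  have \<phi>': "(\<phi> has_derivative ?\<phi>') (at x)" by (rule smooth_on_has_derivative[OF U(2) x])
  then have lin: "linear ?\<phi>'" by (rule has_derivative_linear)
  show "surj \<psi>'"
  proof -
    have "\<exists>u. (\<alpha>, \<beta>) = \<psi>' u" for \<alpha> \<beta>
    proof -
      obtain a where "?\<phi>' a = \<alpha>" using surj\<phi>[of x] xM x by (metis IntI surjD)
      moreover obtain b where "?\<phi>' b = \<beta> - B a" using surj\<phi>[of x] xM x by (metis IntI surjD)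
      ultimately have "(\<alpha>, \<beta>) = \<psi>' (a, b)" by (simp add: \<psi>')
      then show ?thesis ..
    qed
    then show ?thesis unfolding surj_def split_paired_All by blast
  qed
  have kernel: "frechet_derivative \<phi> (at p) w = 0" if "p \<in> M \<inter> U" "w \<in> tangent_space M p" for p w
    using tangent_space_subset_kernel[OF smooth_on_has_derivative[OF U(2)] U(1), of p M c] that U(3) by blast
  have sub: "tangent_space (tangent_bundle M) (x, v) \<subseteq> {u. \<psi>' u = 0}"
  proof (rule tangent_space_subset_kernel[OF D])
    show "open (U \<times> UNIV)" using U(1) by (intro open_Times) auto
    show "(x, v) \<in> U \<times> UNIV" using x by simp
    show "induced_defining_function \<phi> z = (c, 0)" if "z \<in> tangent_bundle M \<inter> U \<times> UNIV" for z
      using that kernel U(3) by (auto simp: induced_defining_function_def tangent_bundle_def)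
  qed
  moreover have "{u. \<psi>' u = 0} \<subseteq> tangent_space (tangent_bundle M) (x, v)"
  proof clarify
    fix a b assume "\<psi>' (a, b) = 0"
    then have ab: "?\<phi>' a = 0" "B a + ?\<phi>' b = 0" by (simp_all add: \<psi>' zero_prod_def)
    obtain W S :: "(real^'n) set" and \<Psi> q where W: "open W" and S: "subspace S" and q: "q \<in> W" and \<Psi>: "smooth_on W \<Psi>"
      and \<Psi>q: "\<Psi> q = x" and WM: "\<And>z. z \<in> W \<Longrightarrow> \<Psi> z \<in> M \<longleftrightarrow> z \<in> S"
      and surj\<Psi>: "surj (frechet_derivative \<Psi> (at q))"
      by (rule embedded_submanifold_parametrization[OF M xM]) (rule that)
    let ?\<Psi>' = "frechet_derivative \<Psi> (at q)"
    have lift: "\<exists>w\<in>S. ?\<Psi>' w = u" if "?\<phi>' u = 0" for u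
    proof (rule level_set_kernel[OF W S q \<Psi> WM surj\<Psi> U(1,2) _ U(3), of u])
      show "\<Psi> q \<in> M \<inter> U" using x xM \<Psi>q by simp
      then show "surj (frechet_derivative \<phi> (at (\<Psi> q)))" by (rule surj\<phi>)
      show "frechet_derivative \<phi> (at (\<Psi> q)) u = 0" using that \<Psi>q by simp
    qed blast+
    obtain w where w: "w \<in> S" "?\<Psi>' w = a" using lift ab(1) by blast
    obtain w0 where w0: "w0 \<in> S" "?\<Psi>' w0 = v" using lift kernel[of x v] xM x vT by blast
    let ?b = "frechet_derivative (\<lambda>z. frechet_derivative \<Psi> (at z) w0) (at q) w"
    have vel: "(a, ?b + ?\<Psi>' w1) \<in> tangent_space (tangent_bundle M) (x, v)" if "w1 \<in> S" for w1
    proof -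
      have "q \<in> W \<inter> S" using WM[OF q] q xM \<Psi>q by simp
      from tangent_bundle_velocity[OF W \<Psi> S _ this w(1) w0(1) that, of M] show ?thesis
        using WM w(2) w0(2) \<Psi>q by simp
    qed
    \<comment> \<open>The curve with \<open>w1 = 0\<close> shows how far its fibre velocity \<open>?b\<close> is from \<open>b\<close>.\<close>
    have "\<psi>' (a, ?b + ?\<Psi>' 0) = 0" using vel[of 0] sub S by (auto intro: subspace_0)
    moreover have "?\<Psi>' 0 = 0"
      using smooth_on_has_derivative[OF \<Psi> q] by (blast intro: has_derivative_linear linear_0)
    ultimately have "B a + ?\<phi>' ?b = 0" by (simp add: \<psi>' zero_prod_def)
    then have "?\<phi>' (b - ?b) = 0" using ab(2) lin by (simp add: linear_diff) (metis add_left_cancel)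
    then obtain w1 where "w1 \<in> S" "?\<Psi>' w1 = b - ?b" using lift by blast
    then show "(a, b) \<in> tangent_space (tangent_bundle M) (x, v)" using vel[of w1] by simp
  qed
  ultimately show "tangent_space (tangent_bundle M) (x, v) = {u. \<psi>' u = 0}" by blast
qed

lemma tangent_space_tangent_bundle_open:
  assumes "open U" "U \<subseteq> M" "x \<in> U"
  shows "tangent_space (tangent_bundle M) (x, v) = UNIV"
proof (rule tangent_space_open)
  show "open (U \<times> UNIV)" using assms(1) by (intro open_Times) auto
  show "U \<times> UNIV \<subseteq> tangent_bundle M"
    using assms tangent_space_open[OF assms(1) _ assms(2)] by (auto simp: tangent_bundle_def)
qed (use assms in simp)


section \<open>Riemannian gradients\<close>

text \<open>An ambient vector \<open>G\<close> representing the derivative along curves may be replaced by its orthogonal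
  projection \<open>g\<close> to the tangent space. Uniqueness tests two candidates on their difference, which
  needs the tangent space to be a subspace.\<close>

lemma riemannian_gradient_eqI:
  assumes T: "subspace (tangent_space N p)" and g: "g \<in> tangent_space N p"
    and deriv: "\<And>\<gamma>. smooth_curve_through N p \<gamma> \<Longrightarrow>
      ((\<lambda>s. f (\<gamma> s)) has_real_derivative (G \<bullet> vector_derivative \<gamma> (at 0))) (at 0)"
    and normal: "\<And>u. u \<in> tangent_space N p \<Longrightarrow> (G - g) \<bullet> u = 0"
  shows "riemannian_gradient N f p = g"
  unfolding riemannian_gradient_def
proof (rule the_equality)
  have vel: "vector_derivative \<gamma> (at 0) \<in> tangent_space N p" if "smooth_curve_through N p \<gamma>" for \<gamma>
    using that unfolding tangent_space_def by blast
  then have eq: "G \<bullet> vector_derivative \<gamma> (at 0) = g \<bullet> vector_derivative \<gamma> (at 0)"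
    if "smooth_curve_through N p \<gamma>" for \<gamma>
    using normal[OF vel[OF that]] by (simp add: inner_diff_left)
  show "has_riemannian_gradient N f p g"
    unfolding has_riemannian_gradient_def using g deriv eq by auto
  fix h assume h: "has_riemannian_gradient N f p h"
  then have "h - g \<in> tangent_space N p"
    unfolding has_riemannian_gradient_def using T g by (blast intro: subspace_diff)
  then obtain \<gamma> where \<gamma>: "smooth_curve_through N p \<gamma>" "h - g = vector_derivative \<gamma> (at 0)"
    unfolding tangent_space_def by blast
  have "h \<bullet> (h - g) = G \<bullet> (h - g)"
    using h deriv[OF \<gamma>(1)] \<gamma> unfolding has_riemannian_gradient_def by (metis DERIV_unique)
  also have "\<dots> = g \<bullet> (h - g)" using eq[OF \<gamma>(1)] by (simp add: \<gamma>(2))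
  finally have "(h - g) \<bullet> (h - g) = 0" by (simp add: inner_diff_left)
  then show "h = g" by simp
qed


section \<open>The regression cost along curves\<close>

text \<open>Relative openness of the residual domain in \<open>TM\<close>, in the form in which it is used: the extensions
  \<open>H i\<close> agree with the residuals only on this domain.\<close>

lemma smooth_curve_eventually_in_residual_domain:
  assumes R: "manifold_retraction M R" and D: "openin (top_of_set M) D"
    and p: "p \<in> residual_domain M R t D"
    and \<gamma>: "smooth_curve_through (tangent_bundle M) p \<gamma>"
  shows "\<forall>\<^sub>F s in nhds 0. \<gamma> s \<in> residual_domain M R t D"
proof -
  let ?TM = "tangent_bundle M"
  let ?\<rho> = "\<lambda>s. (fst (\<gamma> s), t *\<^sub>R snd (\<gamma> s))"
  have scale: "(fst z, t *\<^sub>R snd z) \<in> ?TM" if "z \<in> ?TM" for z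
    using that by (auto simp: tangent_bundle_def intro: tangent_space_scaleR)
  obtain O' where O': "open O'" "D = M \<inter> O'" using D by (auto simp: openin_open)
  have "continuous_on ?TM R"
    using R smooth_map_on_imp_continuous_on unfolding manifold_retraction_def by blast
  then obtain A where A: "open A" "A \<inter> ?TM = R -` O' \<inter> ?TM"
    using O'(1) unfolding continuous_on_open_invariant by blast
  have "isCont ?\<rho> 0" using smooth_curve_throughD(3)[OF \<gamma>] by (intro continuous_intros)
  then have "(?\<rho> \<longlongrightarrow> ?\<rho> 0) (nhds 0)"
    using tendsto_at_iff_tendsto_nhds[of ?\<rho> 0] by (simp add: isCont_def)
  moreover have "?\<rho> 0 \<in> A"
    using p smooth_curve_throughD(1)[OF \<gamma>] scale[of p] O' A(2)
    by (auto simp: residual_domain_def)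
  ultimately have "\<forall>\<^sub>F s in nhds 0. ?\<rho> s \<in> A" using A(1) by (intro topological_tendstoD)
  then show ?thesis using smooth_curve_throughD(4)[OF \<gamma>]
  proof eventually_elim
    case (elim s)
    then have "R (?\<rho> s) \<in> O'" using scale A(2) by blast
    moreover have "R (?\<rho> s) \<in> M" using R scale elim unfolding manifold_retraction_def by blast
    ultimately show ?case using elim O'(2) by (auto simp: residual_domain_def case_prod_beta)
  qed
qed

lemma regression_cost_along_curve:
  assumes R: "manifold_retraction M R"
    and D: "\<forall>i\<in>{1..m}. openin (top_of_set M) (Dy i)"
    and p: "p \<in> regression_domain M R m t Dy"
    and H: "\<forall>i\<in>{1..m}. smooth_extension_near (residual_domain M R (t i) (Dy i))
           (residual R (t i) (y i) (Uy i)) p (H i)"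
    and \<gamma>: "smooth_curve_through (tangent_bundle M) p \<gamma>"
  shows "((\<lambda>s. regression_cost R m t y Uy (\<gamma> s)) has_real_derivative
    (\<Sum>i=1..m. residual R (t i) (y i) (Uy i) p \<bullet>
      frechet_derivative (H i) (at p) (vector_derivative \<gamma> (at 0)))) (at 0)"
proof -
  let ?h = "\<lambda>i. residual R (t i) (y i) (Uy i)"
  let ?H' = "\<lambda>i. frechet_derivative (H i) (at p) (vector_derivative \<gamma> (at 0))"
  have each: "((\<lambda>s. ?h i (\<gamma> s) \<bullet> ?h i (\<gamma> s)) has_real_derivative 2 * (?h i p \<bullet> ?H' i)) (at 0)"
    if i: "i \<in> {1..m}" for i
  proof -
    obtain W where W: "open W" "p \<in> W" "smooth_on W (H i)"
      "\<forall>q \<in> W \<inter> residual_domain M R (t i) (Dy i). H i q = ?h i q"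
      using H i unfolding smooth_extension_near_def by blast
    have pi: "p \<in> residual_domain M R (t i) (Dy i)"
      using p i unfolding regression_domain_def by blast
    have "((\<lambda>s. H i (\<gamma> s)) has_vector_derivative ?H' i) (at 0)"
      using \<gamma> smooth_on_has_derivative[OF W(3,2)] by (rule has_derivative_along_curve)
    then have "((\<lambda>s. H i (\<gamma> s) \<bullet> H i (\<gamma> s)) has_derivative
        (\<lambda>r. H i (\<gamma> 0) \<bullet> (r *\<^sub>R ?H' i) + (r *\<^sub>R ?H' i) \<bullet> H i (\<gamma> 0))) (at 0)"
      unfolding has_vector_derivative_def by (intro has_derivative_inner)
    moreover have "H i (\<gamma> 0) = ?h i p"
      using W pi smooth_curve_throughD(1)[OF \<gamma>] by simp
    ultimately have "((\<lambda>s. H i (\<gamma> s) \<bullet> H i (\<gamma> s)) has_real_derivative 2 * (?h i p \<bullet> ?H' i)) (at 0)"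
      by (simp add: has_field_derivative_def inner_commute algebra_simps mult_commute_abs)
    moreover have "\<forall>\<^sub>F s in nhds 0. H i (\<gamma> s) \<bullet> H i (\<gamma> s) = ?h i (\<gamma> s) \<bullet> ?h i (\<gamma> s)"
      using smooth_curve_eventually_in_residual_domain[OF R bspec[OF D i] pi \<gamma>]
        smooth_curve_eventually_in[OF \<gamma> W(1,2)]
      by eventually_elim (simp add: W(4))
    ultimately show ?thesis by (simp add: DERIV_cong_ev)
  qed
  have "((\<lambda>s. 1 / 2 * (\<Sum>i=1..m. ?h i (\<gamma> s) \<bullet> ?h i (\<gamma> s))) has_real_derivative
      1 / 2 * (\<Sum>i=1..m. 2 * (?h i p \<bullet> ?H' i))) (at 0)"
    using each by (intro DERIV_cmult DERIV_sum) auto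
  then show ?thesis by (simp add: regression_cost_def flip: sum_distrib_left)
qed


section \<open>Standard coordinates and the normal projection\<close>

lemma of_coords_to_coords [simp]: "of_coords (to_coords p) = p"
  by (simp add: of_coords_def to_coords_def)

lemma to_coords_of_coords [simp]: "to_coords (of_coords z) = z"
  by (simp add: of_coords_def to_coords_def vec_eq_iff split: sum.split)

lemma linear_to_coords: "linear to_coords"
  by (rule linearI) (auto simp: to_coords_def vec_eq_iff split: sum.split)

lemma linear_of_coords: "linear of_coords"
  by (rule linearI) (auto simp: of_coords_def vec_eq_iff)

lemma inner_to_coords: "to_coords p \<bullet> to_coords q = p \<bullet> q"
  unfolding inner_vec_def to_coords_def UNIV_Plus_UNIV[symmetric]
  by (subst sum.Plus) (auto simp: inner_prod_def inner_vec_def)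

lemma coord_jacobian_mult:
  assumes "(f has_derivative f') (at p)"
  shows "coord_jacobian f p *v z = f' (of_coords z)"
proof -
  have "(of_coords has_derivative of_coords) (at (to_coords p))"
    by (rule linear_imp_has_derivative[OF linear_of_coords])
  then have "((\<lambda>z. f (of_coords z)) has_derivative (\<lambda>z. f' (of_coords z))) (at (to_coords p))"
    by (rule has_derivative_compose) (simp add: assms)
  note D = this
  then have "((\<lambda>z. f (of_coords z)) has_derivative (\<lambda>h. coord_jacobian f p *v h)) (at (to_coords p))"
    unfolding coord_jacobian_def jacobian_works[symmetric] by (rule differentiableI)
  from has_derivative_unique[OF this D] show ?thesis by (rule fun_cong)
qed

lemma transpose_mult_inner: "(transpose A *v x) \<bullet> y = x \<bullet> (A *v (y :: real^'n))"
  by (metis dot_lmul_matrix transpose_matrix_vector)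

lemma invertible_gram:
  fixes J :: "real^'a^'b"
  assumes "surj ((*v) J)"
  shows "invertible (J ** transpose J)"
proof -
  have "w = 0" if "(J ** transpose J) *v w = 0" for w
  proof -
    have "(transpose J *v w) \<bullet> (transpose J *v w) = w \<bullet> ((J ** transpose J) *v w)"
      by (simp only: transpose_mult_inner matrix_vector_mul_assoc)
    then have "transpose J *v w = 0" using that by simp
    moreover obtain z where "w = J *v z" using assms by (metis surjD)
    ultimately have "w \<bullet> w = 0" using transpose_mult_inner[of J w z] by simp
    then show ?thesis by simp
  qed
  then show ?thesis by (simp add: invertible_left_inverse matrix_left_invertible_ker)
qed

text \<open>The matrix \<open>P\<close> is the orthogonal projection onto the kernel of \<open>J\<close>: its values are killed by \<open>J\<close>,
  and \<open>z - P z\<close> lies in the range of the transpose of \<open>J\<close>, the orthogonal complement of that kernel.\<close>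

lemma kernel_projection:
  fixes J :: "real^'a^'b"
  assumes "surj ((*v) J)"
  defines "P \<equiv> mat 1 - transpose J ** matrix_inv (J ** transpose J) ** J"
  shows "J *v (P *v z) = 0"
    and "J *v u = 0 \<Longrightarrow> (z - P *v z) \<bullet> u = 0"
proof -
  have P: "P *v z = z - transpose J *v (matrix_inv (J ** transpose J) *v (J *v z))"
    unfolding P_def
    by (simp add: matrix_vector_mult_diff_rdistrib matrix_vector_mul_assoc matrix_mul_assoc)
  have "(J ** transpose J) ** matrix_inv (J ** transpose J) = mat 1"
    using invertible_gram[OF assms(1)] unfolding invertible_def matrix_inv_def
    by (rule someI_ex[THEN conjunct1])
  then have "J *v (transpose J *v (matrix_inv (J ** transpose J) *v y)) = y" for y
    by (metis matrix_vector_mul_assoc matrix_vector_mul_lid)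
  then show "J *v (P *v z) = 0" by (simp add: P matrix_vector_mult_diff_distrib)
  show "(z - P *v z) \<bullet> u = 0" if "J *v u = 0"
    using that by (simp add: P transpose_mult_inner del: transpose_matrix_vector)
qed


section \<open>The gradient formula\<close>

theorem mainTheorem4:
  fixes M :: "(real^'n) set" and d :: nat
    and R :: "(real^'n) \<times> (real^'n) \<Rightarrow> real^'n"
    and m :: nat and t :: "nat \<Rightarrow> real" and y :: "nat \<Rightarrow> real^'n"
    and Uy Dy :: "nat \<Rightarrow> (real^'n) set"
    and x v :: "real^'n"
    and H :: "nat \<Rightarrow> (real^'n) \<times> (real^'n) \<Rightarrow> real^'n"
  assumes "embedded_submanifold d M"
    and "manifold_retraction M R"
    and "\<forall>i\<in>{1..m}. y i \<in> M"
    and "\<forall>i\<in>{1..m}. openin (top_of_set (tangent_space M (y i))) (Uy i)"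
    and "\<forall>i\<in>{1..m}. openin (top_of_set M) (Dy i)"
    and "\<forall>i\<in>{1..m}. diffeomorphism_on (Uy i) (Dy i) (\<lambda>w. R (y i, w))"
    and "(x, v) \<in> regression_domain M R m t Dy"
    and "\<forall>i\<in>{1..m}. smooth_extension_near (residual_domain M R (t i) (Dy i))
           (residual R (t i) (y i) (Uy i)) (x, v) (H i)"
  shows
    (* The second conjunct is the codimension k = 0, which the index type 'k cannot express: M \<inter> U = U
       is the level set of the map from U to the one-point space, and the term built from the
       0 x 2n matrix J vanishes. *)
    "(\<forall>(U :: (real^'n) set) (\<phi> :: real^'n \<Rightarrow> real^'k).
       local_defining_function M U \<phi> \<and> x \<in> U \<longrightarrow>
       (let J = coord_jacobian (\<lambda>p. to_coords (induced_defining_function \<phi> p)) (x, v) in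
        to_coords (riemannian_gradient (tangent_bundle M) (regression_cost R m t y Uy) (x, v)) =
        (\<Sum>i=1..m.
           (mat 1 - transpose J ** matrix_inv (J ** transpose J) ** J) *v
           (transpose (coord_jacobian (H i) (x, v)) *v residual R (t i) (y i) (Uy i) (x, v)))))
     \<and>
     (\<forall>U :: (real^'n) set. open U \<and> M \<inter> U = U \<and> x \<in> U \<longrightarrow>
        to_coords (riemannian_gradient (tangent_bundle M) (regression_cost R m t y Uy) (x, v)) =
        (\<Sum>i=1..m. mat 1 *v
           (transpose (coord_jacobian (H i) (x, v)) *v residual R (t i) (y i) (Uy i) (x, v))))"
proof -
  let ?TM = "tangent_bundle M" and ?F = "regression_cost R m t y Uy"
  let ?h = "\<lambda>i. residual R (t i) (y i) (Uy i) (x, v)"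
  let ?z = "\<lambda>i. transpose (coord_jacobian (H i) (x, v)) *v ?h i"
  define G where "G = (\<Sum>i=1..m. ?z i)"
  have xv: "(x, v) \<in> ?TM" using assms(7) by (simp add: regression_domain_def)
  have deriv: "((\<lambda>s. ?F (\<gamma> s)) has_real_derivative (of_coords G \<bullet> vector_derivative \<gamma> (at 0))) (at 0)"
    if \<gamma>: "smooth_curve_through ?TM (x, v) \<gamma>" for \<gamma>
  proof -
    let ?u = "vector_derivative \<gamma> (at 0)"
    have "?h i \<bullet> frechet_derivative (H i) (at (x, v)) ?u = ?z i \<bullet> to_coords ?u" if i: "i \<in> {1..m}" for i
    proof -
      obtain W where "(x, v) \<in> W" "smooth_on W (H i)"
        using bspec[OF assms(8) i] unfolding smooth_extension_near_def by blast
      then have "(H i has_derivative frechet_derivative (H i) (at (x, v))) (at (x, v))"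
        by (intro smooth_on_has_derivative)
      then show ?thesis
        unfolding transpose_mult_inner by (simp add: coord_jacobian_mult)
    qed
    then have "(\<Sum>i=1..m. ?h i \<bullet> frechet_derivative (H i) (at (x, v)) ?u) = G \<bullet> to_coords ?u"
      by (simp add: G_def inner_sum_left)
    also have "\<dots> = of_coords G \<bullet> ?u" using inner_to_coords[of "of_coords G" ?u] by simp
    finally show ?thesis
      using regression_cost_along_curve[OF assms(2,5,7,8) \<gamma>] by simp
  qed
  have sum: "(\<Sum>i=1..m. A *v ?z i) = A *v G" for A :: "real^('n + 'n)^('n + 'n)"
    unfolding G_def by (rule linear_sum[OF matrix_vector_mul_linear, symmetric])
  have "to_coords (riemannian_gradient ?TM ?F (x, v)) =
      (mat 1 - transpose J ** matrix_inv (J ** transpose J) ** J) *v G"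
    if \<phi>: "local_defining_function M U \<phi>" "x \<in> U"
      and J: "J = coord_jacobian (\<lambda>p. to_coords (induced_defining_function \<phi> p)) (x, v)"
    for U and \<phi> :: "real^'n \<Rightarrow> real^'k" and J
  proof -
    define \<psi>' where "\<psi>' = frechet_derivative (induced_defining_function \<phi>) (at (x, v))"
    note TM = tangent_space_tangent_bundle[OF assms(1) \<phi> xv, folded \<psi>'_def]
    have lin: "linear \<psi>'" using TM(1) by (rule has_derivative_linear)
    have "((\<lambda>p. to_coords (induced_defining_function \<phi> p)) has_derivative (\<lambda>u. to_coords (\<psi>' u))) (at (x, v))"
      using TM(1) linear_to_coords
      by (intro bounded_linear.has_derivative[of to_coords]) (simp_all add: linear_conv_bounded_linear)
    then have Jz: "J *v z = to_coords (\<psi>' (of_coords z))" for z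
      unfolding J by (rule coord_jacobian_mult)
    have surjJ: "surj ((*v) J)"
    proof (rule surjI)
      \<comment> \<open>Surjectivity is what makes \<open>J J\<^sup>T\<close> invertible.\<close>
      show "J *v to_coords (inv \<psi>' (of_coords w)) = w" for w
        by (simp add: Jz surj_f_inv_f[OF TM(2)])
    qed
    have kernel: "\<psi>' u = 0 \<longleftrightarrow> J *v to_coords u = 0" for u
      unfolding Jz of_coords_to_coords
      using linear_0[OF linear_to_coords] linear_0[OF linear_of_coords] by (metis of_coords_to_coords)
    let ?P = "mat 1 - transpose J ** matrix_inv (J ** transpose J) ** J"
    have "riemannian_gradient ?TM ?F (x, v) = of_coords (?P *v G)"
    proof (rule riemannian_gradient_eqI[OF _ _ deriv])
      show "subspace (tangent_space ?TM (x, v))"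
        unfolding TM(3) using lin by (rule linear_subspace_kernel)
      show "of_coords (?P *v G) \<in> tangent_space ?TM (x, v)"
        unfolding TM(3) by (simp add: kernel kernel_projection(1)[OF surjJ])
      show "(of_coords G - of_coords (?P *v G)) \<bullet> u = 0" if "u \<in> tangent_space ?TM (x, v)" for u
      proof -
        have "(G - ?P *v G) \<bullet> to_coords u = 0"
          using that unfolding TM(3) by (intro kernel_projection(2)[OF surjJ]) (simp add: kernel)
        then have "of_coords (G - ?P *v G) \<bullet> u = 0"
          using inner_to_coords[of "of_coords (G - ?P *v G)" u] by (simp only: to_coords_of_coords)
        then show ?thesis by (simp only: linear_diff[OF linear_of_coords])
      qed
    qed
    then show ?thesis by simp
  qed
  moreover have "to_coords (riemannian_gradient ?TM ?F (x, v)) = mat 1 *v G"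
    if U: "open U" "M \<inter> U = U" "x \<in> U" for U
  proof -
    have "tangent_space ?TM (x, v) = UNIV"
      using U by (intro tangent_space_tangent_bundle_open[of U]) auto
    then have "riemannian_gradient ?TM ?F (x, v) = of_coords G"
      by (intro riemannian_gradient_eqI[OF _ _ deriv]) auto
    then show ?thesis by simp
  qed
  ultimately show ?thesis unfolding Let_def sum by blast
qed

end
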